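(* Let $n$ be a positive integer and $q$ a prime power, both fixed, and let $m(n)=\left[\frac{n^2}{4}\right]+1$. For a positive integer $k$ let $C(n,k,q)$ be the total number of $k$-tuples $(A_1,\ldots,A_k)$ of pairwise commuting matrices in $M_n(\mathbb{F}_q)$. Then $C(n,k,q)$, as a function of $k$, is asymptotic to $q^{m(n)k}$ up to a constant factor: there exist constants $D_1,D_2>0$ (independent of $k$) such that $D_1q^{m(n)k}\le C(n,k,q)\le D_2 q^{m(n)k}$ for all sufficiently large $k$.
   Context: $\mathbb{F}_q$ is the finite field with $q$ elements, $M_n(\mathbb{F}_q)$ the algebra of $n\times n$ matrices over it, and $[x]$ the integer part of $x$. *)

theory Defs
  imports "Jordan_Normal_Form.Matrix" "HOL-Library.Cardinality"
begin

definition commuting_tuples :: "nat \<Rightarrow> nat \<Rightarrow> 'a :: field mat list set" where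
  "commuting_tuples n k =
     {As. length As = k \<and> set As \<subseteq> carrier_mat n n \<and>
          (\<forall>i<k. \<forall>j<k. As ! i * As ! j = As ! j * As ! i)}"

text \<open>The field with \<open>q\<close> elements is represented by a type \<open>'a\<close> with \<open>CARD('a) = q\<close>;
  the type argument below takes the place of \<open>q\<close>.\<close>

definition num_commuting_tuples :: "'a :: {field, finite} itself \<Rightarrow> nat \<Rightarrow> nat \<Rightarrow> nat" where
  "num_commuting_tuples _ n k = card (commuting_tuples n k :: 'a mat list set)"

definition m_exp :: "nat \<Rightarrow> nat" where
  "m_exp n = n\<^sup>2 div 4 + 1"

lemma finite_carrier_mat: "finite (carrier_mat n n :: 'a :: finite mat set)"
proof -
  let ?I = "{0..<n} \<times> {0..<n}"
  have "carrier_mat n n \<subseteq> mat n n ` (?I \<rightarrow>\<^sub>E (UNIV :: 'a set))"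
  proof
    fix A :: "'a mat" assume A: "A \<in> carrier_mat n n"
    have "A = mat n n (restrict (($$) A) ?I)"
      using A by (intro eq_matI) auto
    then show "A \<in> mat n n ` (?I \<rightarrow>\<^sub>E UNIV)"
      by (metis UNIV_I image_eqI restrict_PiE_iff)
  qed
  moreover have "finite (?I \<rightarrow>\<^sub>E (UNIV :: 'a set))"
    by (intro finite_PiE) auto
  ultimately show ?thesis
    by (meson finite_imageI finite_subset)
qed

text \<open>The cardinality in \<open>num_commuting_tuples\<close> is that of a finite set.\<close>

lemma finite_commuting_tuples:
  "finite (commuting_tuples n k :: 'a :: {field, finite} mat list set)"
  by (rule finite_subset[OF _ finite_lists_length_eq[OF finite_carrier_mat, of n k]])
     (auto simp: commuting_tuples_def)

end

theory Submission
  imports Defs "HOL-Library.Function_Algebras"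
begin

text \<open>
  Every commuting tuple lies in the bicommutant of its entries, which is a commutative algebra
  \<open>A\<close> of matrices; there are finitely many such algebras, each of size at most \<open>q ^ m(n)\<close>, and the
  algebra of scalars plus an arbitrary upper right block attains this size.

  The size bound is shown without extending the field. For \<open>A\<close>-submodules \<open>W \<subseteq> U\<close> with
  \<open>U/W\<close> of dimension \<open>n\<close>, the index in \<open>A\<close> of \<open>ann U W = {a. a U \<subseteq> W}\<close> is bounded by induction
  on \<open>n\<close>. Take \<open>W'\<close> minimal over \<open>W\<close> and \<open>U'\<close> maximal under \<open>U\<close>. If \<open>W' \<subseteq> U'\<close>, let \<open>v \<in> U - U'\<close> and
  \<open>C = (ann U' W) v + W\<close>. Then \<open>ann U' W / ann U W\<close> is isomorphic to \<open>C/W\<close>, while \<open>ann U W'\<close> maps \<open>C\<close>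
  into \<open>W\<close>, so that \<open>ann U W' / ann U W\<close> embeds into \<open>Hom\<^sub>A(U/C, W'/W)\<close>. Hence the dimensions of the
  two quotients add up to at most \<open>n\<close>; combined with the induction hypotheses for \<open>U/W'\<close>
  and \<open>U'/W\<close> this gives \<open>2 dim \<le> 2 m(n - 1) + n\<close>, enough since \<open>m(n) = m(n - 1) + [n/2]\<close>.
  Otherwise \<open>U/W\<close> splits as the sum of \<open>W'/W\<close> and \<open>U'/W\<close>.
\<close>

section \<open>Subgroups and subspaces counted by cardinality\<close>

text \<open>Additive subgroups as plain sets, so that one counting lemma serves for sets of vectors
  and, with pointwise operations, for sets of operators.\<close>

definition diff_closed :: "'b::ab_group_add set \<Rightarrow> bool" where
  "diff_closed G \<longleftrightarrow> 0 \<in> G \<and> (\<forall>x\<in>G. \<forall>y\<in>G. x - y \<in> G)"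

lemma diff_closedD:
  assumes "diff_closed G"
  shows "0 \<in> G" "x \<in> G \<Longrightarrow> y \<in> G \<Longrightarrow> x - y \<in> G" "x \<in> G \<Longrightarrow> y \<in> G \<Longrightarrow> x + y \<in> G"
proof -
  show 0: "0 \<in> G" and d: "x \<in> G \<Longrightarrow> y \<in> G \<Longrightarrow> x - y \<in> G" for x y
    using assms by (auto simp: diff_closed_def)
  show "x + y \<in> G" if "x \<in> G" "y \<in> G"
    using d[OF that(1) d[OF 0 that(2)]] by simp
qed

text \<open>The map that \<open>h\<close> induces from \<open>G\<close> onto
  \<open>(h G + W)/W\<close> has kernel \<open>{g\<in>G. h g \<in> W}\<close>; cardinalities are
  multiplied out to avoid quotients. The fibres of \<open>h g + w\<close> are translates of the set
  of pairs \<open>(k, - h k)\<close> with \<open>k\<close> in the kernel.\<close>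

lemma card_hom_preimage:
  fixes h :: "'b::ab_group_add \<Rightarrow> 'c::ab_group_add"
  assumes G: "finite G" "diff_closed G" and W: "finite W" "diff_closed W"
    and h: "\<And>x y. x \<in> G \<Longrightarrow> y \<in> G \<Longrightarrow> h (x - y) = h x - h y"
  shows "card G * card W = card {g\<in>G. h g \<in> W} * card ((\<lambda>(g, w). h g + w) ` (G \<times> W))"
proof -
  let ?f = "\<lambda>(g, w). h g + w"
  let ?K = "{g\<in>G. h g \<in> W}"
  note Gd = diff_closedD[OF G(2)] and Wd = diff_closedD[OF W(2)]
  have h_add: "h (x + y) = h x + h y" if "x \<in> G" "y \<in> G" for x y
    using h[of "x + y" y] Gd(3)[OF that] that by simp
  have fiber: "card {p \<in> G \<times> W. ?f p = y} = card ?K" if y: "y \<in> ?f ` (G \<times> W)" for y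
  proof -
    obtain g w where gw: "g \<in> G" "w \<in> W" "y = h g + w" using y by auto
    have "bij_betw (\<lambda>k. (g + k, w - h k)) ?K {p \<in> G \<times> W. ?f p = y}"
    proof (rule bij_betwI[where g = "\<lambda>p. fst p - g"])
      show "(\<lambda>k. (g + k, w - h k)) \<in> ?K \<rightarrow> {p \<in> G \<times> W. ?f p = y}"
        using gw Gd Wd h_add by auto
      show "(\<lambda>p. fst p - g) \<in> {p \<in> G \<times> W. ?f p = y} \<rightarrow> ?K"
      proof
        fix p assume p: "p \<in> {p \<in> G \<times> W. ?f p = y}"
        then obtain g' w' where p': "p = (g', w')" "g' \<in> G" "w' \<in> W" "h g' + w' = h g + w"
          using gw by auto
        have "h (g' - g) = h g' - h g" using h gw(1) p'(2) by blast
        also have "\<dots> = w - w'" using p'(4) by (simp add: algebra_simps)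
        finally have "h (g' - g) = w - w'" .
        then show "fst p - g \<in> ?K" using p' gw Gd Wd by simp
      qed
      show "fst (g + k, w - h k) - g = k" for k by simp
      show "(g + (fst p - g), w - h (fst p - g)) = p" if "p \<in> {p \<in> G \<times> W. ?f p = y}" for p
      proof -
        obtain g' w' where p: "p = (g', w')" "g' \<in> G" "h g' + w' = h g + w"
          using \<open>p \<in> _\<close> gw by auto
        moreover have "h (g' - g) = h g' - h g" using h gw(1) p(2) by blast
        moreover have "w - (h g' - h g) = w'" using p(3) by (simp add: algebra_simps)
        ultimately show ?thesis by simp
      qed
    qed
    then show ?thesis by (simp add: bij_betw_same_card)
  qed
  have "card G * card W = (\<Sum>p\<in>G \<times> W. 1)"
    by (simp add: card_cartesian_product)
  also have "\<dots> = (\<Sum>y\<in>?f ` (G \<times> W). \<Sum>p\<in>{p. p \<in> G \<times> W \<and> ?f p = y}. 1)"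
    using G W by (intro sum.image_gen) auto
  also have "\<dots> = (\<Sum>y\<in>?f ` (G \<times> W). card ?K)"
    using fiber by (intro sum.cong) simp_all
  finally show ?thesis by (simp add: mult.commute)
qed

text \<open>Adjoining a vector outside \<open>D\<close> multiplies the size by that of the field.
  The exponent \<open>k\<close> stands for the dimension of \<open>S/D\<close> in all later
  comparisons.\<close>

lemma (in vector_space) card_subspace_power:
  assumes "subspace D" "subspace S" "D \<subseteq> S" "finite S"
  shows "\<exists>k. card S = CARD('a) ^ k * card D"
  using assms
proof (induction "card S - card D" arbitrary: D rule: less_induct)
  case less
  show ?case
  proof (cases "D = S")
    case True
    then show ?thesis by (intro exI[of _ 0]) simp
  next
    case False
    then obtain x where x: "x \<in> S" "x \<notin> D" using less.prems by auto
    let ?D = "(\<lambda>(c, d). scale c x + d) ` (UNIV \<times> D)"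
    have inj: "inj_on (\<lambda>(c, d). scale c x + d) (UNIV \<times> D)"
    proof (rule inj_onI, clarsimp)
      fix c d c' d' assume d: "d \<in> D" "d' \<in> D" and eq: "scale c x + d = scale c' x + d'"
      have "scale (c - c') x = d' - d" using eq by (simp add: algebra_simps)
      then have "scale (c - c') x \<in> D" using d less.prems(1) by (simp add: subspace_diff)
      \<comment> \<open>For \<open>c = c'\<close> the quotient is the default
        \<open>1 / 0 = 0\<close> and this says nothing; otherwise it would put \<open>x\<close> into
        \<open>D\<close>.\<close>
      then have "scale (1 / (c - c')) (scale (c - c') x) \<in> D"
        using less.prems(1) subspace_scale by blast
      then have "c = c'" using x by (cases "c = c'") auto
      then show "c = c' \<and> d = d'" using eq by simp
    qed
    have D: "card ?D = CARD('a) * card D"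
      using card_image[OF inj] by (simp add: card_cartesian_product)
    have sub: "subspace ?D"
    proof (rule subspaceI)
      show "0 \<in> ?D" using subspace_0[OF less.prems(1)] by (intro image_eqI[of _ _ "(0, 0)"]) auto
    next
      fix u v assume "u \<in> ?D" "v \<in> ?D"
      then obtain a b c d where "b \<in> D" "d \<in> D" "u = scale a x + b" "v = scale c x + d" by auto
      then show "u + v \<in> ?D" using subspace_add[OF less.prems(1), of b d]
        by (intro image_eqI[of _ _ "(a + c, b + d)"]) (auto simp: algebra_simps)
    next
      fix r u assume "u \<in> ?D"
      then obtain a b where "b \<in> D" "u = scale a x + b" by auto
      then show "scale r u \<in> ?D" using subspace_scale[OF less.prems(1), of b r]
        by (intro image_eqI[of _ _ "(r * a, scale r b)"]) (auto simp: algebra_simps)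
    qed
    have DS: "?D \<subseteq> S" using less.prems x by (auto intro!: subspace_add subspace_scale)
    have "D \<subseteq> ?D"
    proof
      fix d assume "d \<in> D" then show "d \<in> ?D" by (intro image_eqI[of _ _ "(0, d)"]) auto
    qed
    moreover have "x \<in> ?D"
      using subspace_0[OF less.prems(1)] by (intro image_eqI[of _ _ "(1, 0)"]) auto
    ultimately have "D \<subset> ?D" using x(2) by blast
    then have "card D < card ?D"
      using DS less.prems(4) by (meson finite_subset psubset_card_mono)
    moreover have "card ?D \<le> card S" using DS less.prems(4) by (rule card_mono[rotated])
    ultimately have "card S - card ?D < card S - card D" by linarith
    from less.hyps[OF this sub less.prems(2) DS less.prems(4)]
    obtain k where "card S = CARD('a) ^ k * card ?D" by blast
    then have "card S = CARD('a) ^ (Suc k) * card D" using D by simp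
    then show ?thesis by blast
  qed
qed

section \<open>Modules over a commutative algebra of operators\<close>

text \<open>\<open>scale_A\<close> supplies zero, the identity and, with \<open>A_commute\<close>,
  linearity over the field. The space may be infinite; finiteness is asked of \<open>A\<close> and
  of each submodule, where cardinalities measure dimension.\<close>

locale commutative_operators = vector_space scale
  for scale :: "'a::{field,finite} \<Rightarrow> 'v::ab_group_add \<Rightarrow> 'v" +
  fixes A :: "('v \<Rightarrow> 'v) set"
  assumes finite_A: "finite A"
    and A_add: "a \<in> A \<Longrightarrow> a (x + y) = a x + a y"
    and plus_A: "a \<in> A \<Longrightarrow> b \<in> A \<Longrightarrow> (\<lambda>x. a x + b x) \<in> A"
    and comp_A: "a \<in> A \<Longrightarrow> b \<in> A \<Longrightarrow> (\<lambda>x. a (b x)) \<in> A"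
    and scale_A: "scale c \<in> A"
    and A_commute: "a \<in> A \<Longrightarrow> b \<in> A \<Longrightarrow> a (b x) = b (a x)"
begin

definition submodule :: "'v set \<Rightarrow> bool" where
  "submodule W \<longleftrightarrow> finite W \<and> 0 \<in> W \<and> (\<forall>x\<in>W. \<forall>y\<in>W. x + y \<in> W) \<and> (\<forall>a\<in>A. \<forall>x\<in>W. a x \<in> W)"

definition ideal :: "('v \<Rightarrow> 'v) set \<Rightarrow> bool" where
  "ideal I \<longleftrightarrow> I \<subseteq> A \<and> 0 \<in> I \<and> (\<forall>a\<in>I. \<forall>b\<in>I. a + b \<in> I) \<and> (\<forall>a\<in>A. \<forall>b\<in>I. (\<lambda>x. a (b x)) \<in> I)"

text \<open>The colon ideal (W : U); for submodules \<open>W \<subseteq> U\<close> it is the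
  annihilator of \<open>U/W\<close>.\<close>

definition ann :: "'v set \<Rightarrow> 'v set \<Rightarrow> ('v \<Rightarrow> 'v) set" where
  "ann U W = {a\<in>A. \<forall>u\<in>U. a u \<in> W}"

text \<open>Makes ideals of \<open>A\<close> subspaces, so that \<open>card_subspace_power\<close>
  applies to their indices too.\<close>

sublocale fun_space: vector_space "\<lambda>c (f :: 'v \<Rightarrow> 'v) x. scale c (f x)"
  by unfold_locales (auto simp: fun_eq_iff algebra_simps)

lemma A_0: "a \<in> A \<Longrightarrow> a 0 = 0"
  using A_add[of a 0 0] by simp

lemma A_diff: "a \<in> A \<Longrightarrow> a (x - y) = a x - a y"
  using A_add[of a "x - y" y] by simp

lemma id_A: "id \<in> A"
  using scale_A[of 1] by (simp add: id_def)

lemma submoduleD: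
  assumes "submodule W"
  shows "finite W" "0 \<in> W" "x \<in> W \<Longrightarrow> y \<in> W \<Longrightarrow> x + y \<in> W" "a \<in> A \<Longrightarrow> x \<in> W \<Longrightarrow> a x \<in> W"
  using assms by (auto simp: submodule_def)

lemma submodule_subspace: "submodule W \<Longrightarrow> subspace W"
  using scale_A by (auto simp: submodule_def subspace_def)

lemma submodule_diff_closed: "submodule W \<Longrightarrow> diff_closed W"
  using submodule_subspace subspace_diff by (auto simp: diff_closed_def submodule_def)

lemma card_submodule_pos: "submodule W \<Longrightarrow> card W > 0"
  by (auto simp: submodule_def card_gt_0_iff)

lemma idealD:
  assumes "ideal I"
  shows "finite I" "I \<subseteq> A" "0 \<in> I" "a \<in> I \<Longrightarrow> b \<in> I \<Longrightarrow> a + b \<in> I"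
    "a \<in> A \<Longrightarrow> b \<in> I \<Longrightarrow> (\<lambda>x. a (b x)) \<in> I"
  using assms finite_A by (auto simp: ideal_def intro: finite_subset)

lemma ideal_subspace: "ideal I \<Longrightarrow> fun_space.subspace I"
  using scale_A by (auto simp: ideal_def fun_space.subspace_def)

lemma ideal_diff_closed: "ideal I \<Longrightarrow> diff_closed I"
  using ideal_subspace fun_space.subspace_diff by (auto simp: diff_closed_def ideal_def)

lemma card_ideal_pos: "ideal I \<Longrightarrow> card I > 0"
  using idealD by (auto simp: card_gt_0_iff)

lemma zero_A: "0 \<in> A"
  using scale_A[of 0] by (simp add: zero_fun_def)

lemma ideal_A: "ideal A"
  using zero_A plus_A comp_A by (auto simp: ideal_def plus_fun_def)

lemma ideal_ann: "submodule W \<Longrightarrow> ideal (ann U W)"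
  using submoduleD zero_A plus_A comp_A by (auto simp: ideal_def ann_def plus_fun_def)

lemma ideal_Int: "ideal I \<Longrightarrow> ideal J \<Longrightarrow> ideal (I \<inter> J)"
  by (auto simp: ideal_def)

lemma submodule_Int: "submodule U \<Longrightarrow> submodule W \<Longrightarrow> submodule (U \<inter> W)"
  by (auto simp: submodule_def)

lemma submodule_orbit:
  assumes I: "ideal I" and W: "submodule W"
  shows "submodule ((\<lambda>(a, w). a x + w) ` (I \<times> W))" (is "submodule ?S")
  unfolding submodule_def
proof (intro conjI ballI)
  note I = idealD[OF I] and W = submoduleD[OF W]
  show "finite ?S" using I(1) W(1) by simp
  show "0 \<in> ?S" using I(3) W(2) by (intro image_eqI[of _ _ "(0, 0)"]) auto
  show "u + v \<in> ?S" if "u \<in> ?S" "v \<in> ?S" for u v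
  proof -
    obtain a b c d where *: "a \<in> I" "b \<in> W" "c \<in> I" "d \<in> W" "u = a x + b" "v = c x + d"
      using \<open>u \<in> ?S\<close> \<open>v \<in> ?S\<close> by auto
    show ?thesis
      using * I W by (intro image_eqI[of _ _ "(a + c, b + d)"]) (auto simp: algebra_simps)
  qed
  show "b u \<in> ?S" if "b \<in> A" "u \<in> ?S" for b u
  proof -
    obtain a w where *: "a \<in> I" "w \<in> W" "u = a x + w" using \<open>u \<in> ?S\<close> by auto
    show ?thesis
      using * I W A_add \<open>b \<in> A\<close> by (intro image_eqI[of _ _ "(\<lambda>x. b (a x), b w)"]) auto
  qed
qed

text \<open>Since \<open>A\<close> is commutative, \<open>a\<close> is a module endomorphism; adding
  \<open>W\<close> amounts to taking the image modulo \<open>W\<close>.\<close>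

lemma submodule_image:
  assumes D: "submodule D" and W: "submodule W" and a: "a \<in> A"
  shows "submodule ((\<lambda>(d, w). a d + w) ` (D \<times> W))" (is "submodule ?S")
  unfolding submodule_def
proof (intro conjI ballI)
  note D = submoduleD[OF D] and W = submoduleD[OF W]
  show "finite ?S" using D(1) W(1) by simp
  show "0 \<in> ?S" using D(2) W(2) A_0[OF a] by (intro image_eqI[of _ _ "(0, 0)"]) auto
  show "u + v \<in> ?S" if "u \<in> ?S" "v \<in> ?S" for u v
  proof -
    obtain p w p' w' where *: "p \<in> D" "w \<in> W" "p' \<in> D" "w' \<in> W" "u = a p + w" "v = a p' + w'"
      using \<open>u \<in> ?S\<close> \<open>v \<in> ?S\<close> by auto
    show ?thesis
      using * D W A_add[OF a] by (intro image_eqI[of _ _ "(p + p', w + w')"]) (auto simp: algebra_simps)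
  qed
  show "b u \<in> ?S" if "b \<in> A" "u \<in> ?S" for b u
  proof -
    obtain p w where *: "p \<in> D" "w \<in> W" "u = a p + w" using \<open>u \<in> ?S\<close> by auto
    show ?thesis
      using * D W A_add \<open>b \<in> A\<close> A_commute[OF a \<open>b \<in> A\<close>]
      by (intro image_eqI[of _ _ "(b p, b w)"]) auto
  qed
qed

section \<open>Simple sections of a module\<close>

text \<open>For a submodule \<open>W\<close> this says that \<open>W'/W\<close> is a simple
  module.\<close>

definition minimal_over :: "'v set \<Rightarrow> 'v set \<Rightarrow> bool" where
  "minimal_over W W' \<longleftrightarrow> submodule W' \<and> W \<subset> W' \<and>
     (\<forall>X. submodule X \<longrightarrow> W \<subseteq> X \<longrightarrow> X \<subseteq> W' \<longrightarrow> X = W \<or> X = W')"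

lemma ex_minimal_over:
  assumes "submodule U" "W \<subset> U"
  obtains W' where "minimal_over W W'" "W' \<subseteq> U"
proof -
  obtain W' where W': "submodule W' \<and> W \<subset> W' \<and> W' \<subseteq> U"
    and least: "\<forall>X. submodule X \<and> W \<subset> X \<and> X \<subseteq> U \<longrightarrow> card W' \<le> card X"
    using ex_has_least_nat[of "\<lambda>X. submodule X \<and> W \<subset> X \<and> X \<subseteq> U" U card] assms by blast
  have "X = W \<or> X = W'" if X: "submodule X" "W \<subseteq> X" "X \<subseteq> W'" for X
  proof (cases "X = W")
    case False
    then have "W \<subset> X" "X \<subseteq> U" using X W' by auto
    then have "card W' \<le> card X" using least X(1) by simp
    moreover have "finite W'" using W' submoduleD(1) by simp
    ultimately show ?thesis using card_seteq[OF _ X(3)] by simp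
  qed simp
  then show ?thesis using that W' by (auto simp: minimal_over_def)
qed

lemma ex_maximal_under:
  assumes "submodule W" "submodule U" "W \<subset> U"
  obtains U' where "submodule U'" "W \<subseteq> U'" "U' \<subset> U"
    "\<And>X. submodule X \<Longrightarrow> U' \<subseteq> X \<Longrightarrow> X \<subseteq> U \<Longrightarrow> X = U' \<or> X = U"
proof -
  have fU: "finite U" using assms submoduleD by blast
  let ?P = "\<lambda>X. submodule X \<and> W \<subseteq> X \<and> X \<subset> U"
  obtain U' where U': "?P U'"
    and least: "\<forall>X. ?P X \<longrightarrow> card U - card U' \<le> card U - card X"
    using ex_has_least_nat[of ?P W "\<lambda>X. card U - card X"] assms by blast
  have "X = U' \<or> X = U" if X: "submodule X" "U' \<subseteq> X" "X \<subseteq> U" for X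
  proof (cases "X = U")
    case False
    then have "card U - card U' \<le> card U - card X" "card X < card U"
      using least X U' psubset_card_mono[OF fU, of X] by auto
    then have "card X \<le> card U'" by linarith
    then show ?thesis using card_seteq[OF submoduleD(1)[OF X(1)] X(2)] by blast
  qed simp
  then show ?thesis using that U' by blast
qed

text \<open>Since \<open>W'/W\<close> is simple, it is a one-dimensional vector space over a quotient field of \<open>A\<close>,
  so that \<open>U/C\<close> has at least as many elements as \<open>Hom\<^sub>A(U/C, W'/W)\<close>; the proof extends \<open>C\<close> by
  one cyclic submodule at a time.\<close>

lemma card_hom_into_simple:
  assumes "minimal_over W W'" and W: "submodule W" and U: "submodule U"
    and "submodule C" "W \<subseteq> C" "C \<subseteq> U" "W' \<subseteq> U"
  shows "card (ann U W' \<inter> ann C W) * card C \<le> card (ann U W) * card U"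
  using assms(4-)
proof (induction "card U - card C" arbitrary: C rule: less_induct)
  case less
  have W': "submodule W'" and WW': "W \<subset> W'" using assms(1) by (auto simp: minimal_over_def)
  \<comment> \<open>Modulo \<open>ann U W\<close>, these are the maps from \<open>U/C\<close> to
    \<open>W'/W\<close> that elements of \<open>A\<close> induce.\<close>
  let ?J = "\<lambda>C. ann U W' \<inter> ann C W"
  show ?case
  proof (cases "C = U")
    case True
    then have "?J C = ann U W" using WW' by (auto simp: ann_def)
    then show ?thesis using True by simp
  next
    case False
    then obtain x where x: "x \<in> U" "x \<notin> C" using less.prems by auto
    define D where "D = (\<lambda>(a, c). a x + c) ` (A \<times> C)"
    have D: "submodule D" unfolding D_def using submodule_orbit ideal_A less.prems by blast
    have CD: "C \<subseteq> D"
    proof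
      fix c assume "c \<in> C" then show "c \<in> D" unfolding D_def using zero_A by (intro image_eqI[of _ _ "(0, c)"]) auto
    qed
    have xD: "x \<in> D"
      unfolding D_def using id_A submoduleD[OF less.prems(1)] by (intro image_eqI[of _ _ "(id, 0)"]) auto
    have DU: "D \<subseteq> U" unfolding D_def using submoduleD[OF U] x less.prems by auto
    have "C \<subset> D" using CD xD x(2) by blast
    then have "card C < card D" using D submoduleD(1) psubset_card_mono by blast
    moreover have "card D \<le> card U" using DU submoduleD(1)[OF U] card_mono by blast
    ultimately have "card U - card D < card U - card C" by linarith
    then have IH: "card (?J D) * card D \<le> card (ann U W) * card U"
      using less.hyps[of D] D CD DU less.prems by blast
    \<comment> \<open>On \<open>D = A x + C\<close> an operator is known, by commutativity, from its
      values at \<open>x\<close> and on \<open>C\<close>.\<close>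
    have JD: "?J D = {a \<in> ?J C. a x \<in> W}"
    proof
      show "?J D \<subseteq> {a \<in> ?J C. a x \<in> W}" using CD xD unfolding ann_def by blast
      show "{a \<in> ?J C. a x \<in> W} \<subseteq> ?J D"
      proof
        fix a assume "a \<in> {a \<in> ?J C. a x \<in> W}"
        then have a: "a \<in> ann U W'" "a \<in> ann C W" "a x \<in> W" by auto
        then have "a \<in> A" by (simp add: ann_def)
        have "a (b x + c) \<in> W" if "b \<in> A" "c \<in> C" for b c
        proof -
          have "a (b x + c) = b (a x) + a c"
            using A_add[OF \<open>a \<in> A\<close>] A_commute[OF \<open>a \<in> A\<close> that(1)] by simp
          then show ?thesis using a that submoduleD[OF W] by (simp add: ann_def)
        qed
        then show "a \<in> ?J D" using a by (auto simp: ann_def D_def)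
      qed
    qed
    \<comment> \<open>If some \<open>a\<close> in \<open>?J C\<close> moves \<open>x\<close> out of
      \<open>W\<close>, then |?J C / ?J D| \<le> |W'/W| \<le> |D/C|: evaluation at \<open>x\<close>
      embeds the first quotient into \<open>W'/W\<close>, and by simplicity \<open>a\<close> maps
      \<open>D/C\<close> onto \<open>W'/W\<close>.\<close>
    have "card (?J C) * card C \<le> card (?J D) * card D"
    proof (cases "\<forall>a\<in>?J C. a x \<in> W")
      case True
      then have "?J D = ?J C" using JD by blast
      moreover have "card C \<le> card D" using \<open>card C < card D\<close> by simp
      ultimately show ?thesis by simp
    next
      case False
      then obtain a where a: "a \<in> ?J C" "a x \<notin> W" by blast
      then have aA: "a \<in> A" by (simp add: ann_def)
      have J: "ideal (?J C)" using ideal_Int ideal_ann W W' by blast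
      have "card (?J C) * card W
          = card {b \<in> ?J C. b x \<in> W} * card ((\<lambda>(b, w). b x + w) ` (?J C \<times> W))"
        using idealD[OF J] ideal_diff_closed[OF J] submoduleD(1)[OF W] submodule_diff_closed[OF W]
        by (intro card_hom_preimage) auto
      moreover have "(\<lambda>(b, w). b x + w) ` (?J C \<times> W) \<subseteq> W'"
        using submoduleD(3)[OF W'] WW' x by (auto simp: ann_def)
      note mult_le_mono2[OF card_mono[OF submoduleD(1)[OF W'] this]]
      ultimately have 1: "card (?J C) * card W \<le> card (?J D) * card W'"
        unfolding JD by simp
      let ?X = "(\<lambda>(d, w). a d + w) ` (D \<times> W)"
      have X: "submodule ?X" using submodule_image D W aA by blast
      have "a d \<in> W'" if "d \<in> D" for d using DU a that by (auto simp: ann_def)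
      then have "?X \<subseteq> W'" using submoduleD(3)[OF W'] WW' by auto
      moreover have "w \<in> ?X" if "w \<in> W" for w
        using that submoduleD(2)[OF D] A_0[OF aA] by (intro image_eqI[of _ _ "(0, w)"]) auto
      moreover have "a x \<in> ?X" using xD submoduleD(2)[OF W] by (intro image_eqI[of _ _ "(x, 0)"]) auto
      ultimately have XW': "?X = W'" using assms(1) X a(2) unfolding minimal_over_def by blast
      have "card D * card W = card {d \<in> D. a d \<in> W} * card ?X"
        using submoduleD(1) submodule_diff_closed D W A_diff[OF aA]
        by (intro card_hom_preimage) blast+
      moreover have "C \<subseteq> {d \<in> D. a d \<in> W}" using CD a by (auto simp: ann_def)
      then have "card C \<le> card {d \<in> D. a d \<in> W}"
        using submoduleD(1)[OF D] by (intro card_mono) auto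
      ultimately have 2: "card C * card W' \<le> card D * card W" using XW' by simp
      have "card (?J C) * card C * card W' \<le> card (?J C) * (card D * card W)"
        using 2 by (simp add: mult.assoc)
      also have "\<dots> = card (?J C) * card W * card D" by (simp only: ac_simps)
      also have "\<dots> \<le> card (?J D) * card W' * card D" using 1 by (intro mult_right_mono) auto
      finally have "card (?J C) * card C * card W' \<le> card (?J D) * card D * card W'"
        by (simp only: ac_simps)
      then show ?thesis using card_submodule_pos[OF W'] by simp
    qed
    then show ?thesis using IH by linarith
  qed
qed

section \<open>Arithmetic of the dimension bound\<close>

text \<open>The value at 0 is not \<open>m_exp 0 = 1\<close>, because the induction over sections \<open>U/W\<close> needs the
  bound 0 for the zero section.\<close>

definition dim_bound :: "nat \<Rightarrow> nat" where
  "dim_bound n = (if n = 0 then 0 else n\<^sup>2 div 4 + 1)"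

text \<open>Serves the case where a summand of dimension \<open>e\<close> splits off. With
  \<open>m = n - e > 0\<close>, the square grows by \<open>e * (2 * m + e)\<close>, which is at
  least \<open>4 * e\<close> except for \<open>m = e = 1\<close>, where rounding 1/4 down to 0 saves
  the claim.\<close>

lemma dim_bound_add:
  assumes "0 < e" "e \<le> n"
  shows "dim_bound (n - e) + e \<le> dim_bound n"
proof (cases "e = n")
  case True
  \<comment> \<open>This is \<open>(n - 2)^2 \<ge> 0\<close>, taken over the integers because
    subtraction of naturals truncates.\<close>
  have "4 * int n \<le> int n ^ 2 + 4"
    using zero_le_power2[of "int n - 2"] by (simp add: power2_eq_square algebra_simps)
  then have "4 * n \<le> n\<^sup>2 + 4" 
    using of_nat_le_iff[of "4 * n" "n\<^sup>2 + 4", where 'a = int] by simp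
  then show ?thesis using True assms by (simp add: dim_bound_def)
next
  case False
  define m where "m = n - e"
  have n: "n = m + e" "0 < m" using False assms by (auto simp: m_def)
  have "m\<^sup>2 div 4 + e \<le> (m + e)\<^sup>2 div 4"
  proof (cases "m = 1 \<and> e = 1")
    case False
    then have "4 \<le> 2 * m + e" using n assms by linarith
    then have "e * 4 \<le> e * (2 * m + e)" by (rule mult_le_mono2)
    then have "m\<^sup>2 + 4 * e \<le> (m + e)\<^sup>2" by (simp add: power2_eq_square algebra_simps)
    then have "(m\<^sup>2 + e * 4) div 4 \<le> (m + e)\<^sup>2 div 4" by (intro div_le_mono) simp
    then show ?thesis by simp
  qed (simp add: power2_eq_square)
  then show ?thesis using n by (simp add: dim_bound_def)
qed

text \<open>Both sections contribute at most the bound for \<open>n - 1\<close>. Halving then gives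
  \<open>n/2\<close> rounded down, since \<open>a\<close> is an integer, and this is exactly the
  growth of \<open>n^2 div 4\<close> from \<open>n - 1\<close> to \<open>n\<close>.\<close>

lemma dim_bound_double:
  assumes "0 < e" "e < n" "0 < e'" "e' < n" "2 * a \<le> dim_bound (n - e) + dim_bound (n - e') + n"
  shows "a \<le> dim_bound n"
proof -
  have le: "dim_bound (n - x) \<le> (n - 1)\<^sup>2 div 4 + 1" if "0 < x" "x < n" for x
    using that by (auto simp: dim_bound_def intro!: div_le_mono power_mono)
  have a: "2 * a \<le> 2 * ((n - 1)\<^sup>2 div 4) + 2 + n"
    using le[OF assms(1,2)] le[OF assms(3,4)] assms(5) by linarith
  have "a \<le> n\<^sup>2 div 4 + 1"
  proof (cases "even n")
    case True
    then obtain k where k: "n = 2 * Suc k" using assms by (metis dvdE gr0_implies_Suc mult_eq_0_iff not_gr_zero not_less0)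
    have sq: "(n - 1)\<^sup>2 = 1 + 4 * (k\<^sup>2 + k)" "n\<^sup>2 = 4 * (k\<^sup>2 + 2 * k + 1)"
      by (simp_all add: k power2_eq_square algebra_simps)
    have d: "(n - 1)\<^sup>2 div 4 = k\<^sup>2 + k" "n\<^sup>2 div 4 = k\<^sup>2 + 2 * k + 1"
      unfolding sq by simp_all
    show ?thesis using a unfolding d by (simp add: k)
  next
    case False
    then obtain k where k: "n = 2 * k + 1" by (elim oddE)
    have sq: "(n - 1)\<^sup>2 = 4 * k\<^sup>2" "n\<^sup>2 = 1 + 4 * (k\<^sup>2 + k)"
      by (simp_all add: k power2_eq_square algebra_simps)
    have d: "(n - 1)\<^sup>2 div 4 = k\<^sup>2" "n\<^sup>2 div 4 = k\<^sup>2 + k"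
      unfolding sq by simp_all
    show ?thesis using a unfolding d by (simp add: k)
  qed
  then show ?thesis using assms by (simp add: dim_bound_def)
qed

section \<open>The index of the annihilator of a section\<close>

text \<open>The induction runs over sections \<open>U/W\<close> with \<open>A\<close> kept fixed, so
  the hypotheses apply to \<open>U/W'\<close> and \<open>U'/W\<close> without passing to quotient
  modules or quotient algebras.\<close>

theorem card_le_ann:
  assumes "submodule U" "submodule W" "W \<subseteq> U" "card U = CARD('a) ^ n * card W"
  shows "card A \<le> CARD('a) ^ dim_bound n * card (ann U W)"
  using assms
proof (induction n arbitrary: U W rule: less_induct)
  case (less n)
  note U = less.prems(1) and W = less.prems(2)
  let ?q = "CARD('a)"
  have q: "?q > 1"
    using card_mono[of "UNIV :: 'a set" "{0, 1}"] by simp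
  note posW = card_submodule_pos[OF W]
  show ?case
  proof (cases "n = 0")
    case True
    then have "W = U" using less.prems card_seteq[OF submoduleD(1)[OF U], of W] by simp
    then have "ann U W = A" using submoduleD(4)[OF U] by (auto simp: ann_def)
    then show ?thesis using True by (simp add: dim_bound_def)
  next
    case False
    have "1 < ?q ^ n" using one_less_power[OF q] False by blast
    then have "W \<noteq> U" using less.prems(4) posW by auto
    then have WU: "W \<subset> U" using less.prems(3) by blast
    obtain W' where min: "minimal_over W W'" and W'U: "W' \<subseteq> U"
      using ex_minimal_over[OF U WU] by blast
    have W': "submodule W'" and WW': "W \<subset> W'" using min by (auto simp: minimal_over_def)
    obtain U' where U': "submodule U'" "W \<subseteq> U'" "U' \<subset> U"
      and max: "\<And>X. submodule X \<Longrightarrow> U' \<subseteq> X \<Longrightarrow> X \<subseteq> U \<Longrightarrow> X = U' \<or> X = U"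
      using ex_maximal_under[OF W U WU] by blast
    have power: "\<exists>k. card Y = ?q ^ k * card X" if "submodule X" "submodule Y" "X \<subseteq> Y" for X Y
      using card_subspace_power[of X Y] submodule_subspace submoduleD(1) that by blast
    have pos: "0 < k" if "X \<subset> Y" "submodule Y" "card Y = ?q ^ k * card X" for X Y k
      using psubset_card_mono[OF submoduleD(1)[OF that(2)] that(1)] that(3) by (cases k) auto
    \<comment> \<open>\<open>e\<close> and \<open>f\<close> are the dimensions of
      \<open>W'/W\<close> and \<open>U/W'\<close>.\<close>
    obtain e where e: "card W' = ?q ^ e * card W" using power W W' WW' by blast
    obtain f where f: "card U = ?q ^ f * card W'" using power U W' W'U by blast
    have "e + f = n"
      using less.prems(4) e f posW q by (simp add: power_add[symmetric])
    then have f_eq: "f = n - e" and "e \<le> n" by auto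
    have "e > 0" using pos WW' W' e by blast
    have bound_W': "card A \<le> ?q ^ dim_bound (n - e) * card (ann U W')"
      using less.IH[of "n - e" U W'] f f_eq U W' W'U \<open>e > 0\<close> False by simp
    have I0: "ideal (ann U W)" using ideal_ann W by blast
    show ?thesis
    proof (cases "W' \<subseteq> U'")
      case True
      obtain e' where e': "card U = ?q ^ e' * card U'" using power U U' by blast
      obtain f' where f': "card U' = ?q ^ f' * card W" using power W U' by blast
      have "e' + f' = n"
        using less.prems(4) e' f' posW q by (simp add: power_add[symmetric])
      then have f'_eq: "f' = n - e'" and "e' \<le> n" by auto
      have "e' > 0" using pos U' U e' by blast
      have "f' > 0" using pos[OF _ U'(1) f'] True WW' by blast
      have "f > 0" using pos[OF _ U f] True U' by blast
      have bound_U': "card A \<le> ?q ^ dim_bound (n - e') * card (ann U' W)"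
        using less.IH[of "n - e'" U' W] f' f'_eq U' W \<open>e' > 0\<close> False by simp
      obtain v where v: "v \<in> U" "v \<notin> U'" using U' by blast
      let ?I = "ann U' W"
      have I: "ideal ?I" using ideal_ann W by blast
      define C where "C = (\<lambda>(b, w). b v + w) ` (?I \<times> W)"
      have C: "submodule C" unfolding C_def using submodule_orbit I W by blast
      have WC: "W \<subseteq> C"
      proof
        fix w assume "w \<in> W" then show "w \<in> C"
          unfolding C_def using idealD(3)[OF I] by (intro image_eqI[of _ _ "(0, w)"]) auto
      qed
      have CU: "C \<subseteq> U" unfolding C_def using submoduleD[OF U] v less.prems(3) by (auto simp: ann_def)
      \<comment> \<open>By maximality of \<open>U'\<close>, \<open>U = A v + U'\<close>. Hence
        sending \<open>b\<close> to \<open>b v\<close> identifies \<open>ann U' W / ann U W\<close>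
        with \<open>C/W\<close>.\<close>
      define V where "V = (\<lambda>(a, u). a v + u) ` (A \<times> U')"
      have V: "submodule V" unfolding V_def using submodule_orbit ideal_A U'(1) by blast
      have "u \<in> V" if "u \<in> U'" for u
        unfolding V_def using that zero_A by (intro image_eqI[of _ _ "(0, u)"]) auto
      moreover have "v \<in> V"
        unfolding V_def using id_A submoduleD(2)[OF U'(1)] by (intro image_eqI[of _ _ "(id, 0)"]) auto
      moreover have "V \<subseteq> U" unfolding V_def using submoduleD[OF U] v U' by auto
      ultimately have VU: "V = U" using max[OF V] v by blast
      have "{b \<in> ?I. b v \<in> W} = ann U W"
      proof
        show "ann U W \<subseteq> {b \<in> ?I. b v \<in> W}" using v U' unfolding ann_def by blast
        show "{b \<in> ?I. b v \<in> W} \<subseteq> ann U W"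
        proof
          fix b assume "b \<in> {b \<in> ?I. b v \<in> W}"
          then have b: "b \<in> A" "\<And>u. u \<in> U' \<Longrightarrow> b u \<in> W" "b v \<in> W" by (auto simp: ann_def)
          have "b (a v + u) \<in> W" if "a \<in> A" "u \<in> U'" for a u
          proof -
            have "b (a v + u) = a (b v) + b u"
              using A_add[OF b(1)] A_commute[OF b(1) that(1)] by simp
            then show ?thesis using b that submoduleD[OF W] by simp
          qed
          then show "b \<in> ann U W" using b(1) VU by (auto simp: ann_def V_def)
        qed
      qed
      moreover have "card ?I * card W = card {b \<in> ?I. b v \<in> W} * card C"
        unfolding C_def
        using idealD[OF I] ideal_diff_closed[OF I] submoduleD(1)[OF W] submodule_diff_closed[OF W]
        by (intro card_hom_preimage) auto
      ultimately have cardC: "card ?I * card W = card (ann U W) * card C" by simp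
      \<comment> \<open>\<open>a (b v) = b (a v)\<close>, where \<open>a v\<close> lies in
        \<open>W' \<subseteq> U'\<close> and \<open>b\<close> maps \<open>U'\<close> into
        \<open>W\<close>.\<close>
      have "a c \<in> W" if a: "a \<in> ann U W'" and "c \<in> C" for a c
      proof -
        obtain b w where c: "b \<in> ?I" "w \<in> W" "c = b v + w" using \<open>c \<in> C\<close> by (auto simp: C_def)
        have "a \<in> A" "b \<in> A" using a c by (auto simp: ann_def)
        then have "a c = b (a v) + a w" using A_add[of a] A_commute[of a b v] c by simp
        moreover have "a v \<in> U'" using a v True by (auto simp: ann_def)
        ultimately show ?thesis using c submoduleD[OF W] \<open>a \<in> A\<close> by (simp add: ann_def)
      qed
      then have "ann U W' \<inter> ann C W = ann U W'" by (auto simp: ann_def)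
      then have hom: "card (ann U W') * card C \<le> card (ann U W) * card U"
        using card_hom_into_simple[OF min W U C WC CU W'U] by simp
      obtain a where a: "card A = ?q ^ a * card (ann U W)"
        using fun_space.card_subspace_power[of "ann U W" A] ideal_subspace[OF I0]
          ideal_subspace[OF ideal_A] idealD(2)[OF I0] finite_A by blast
      \<comment> \<open>The size of \<open>C\<close> cancels: \<open>?c1 / ?c\<close> is at most
        |U/C| and \<open>?c2 / ?c\<close> equals |C/W|, so their product is at most |U/W|.\<close>
      let ?c = "card (ann U W)" and ?c1 = "card (ann U W')" and ?c2 = "card ?I"
      have "?c1 * ?c2 * card W = ?c1 * card C * ?c" using cardC by (simp add: ac_simps)
      also have "\<dots> \<le> ?c * card U * ?c" using hom by simp
      also have "\<dots> = ?q ^ n * ?c * ?c * card W" using less.prems(4) by (simp add: ac_simps)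
      finally have c12: "?c1 * ?c2 \<le> ?q ^ n * ?c * ?c" using posW by simp
      \<comment> \<open>Squaring \<open>card A\<close> brings in each of the two induction
        hypotheses once.\<close>
      have "?q ^ (2 * a) * (?c * ?c) = card A * card A"
        unfolding power_even_eq power2_eq_square a by (simp only: ac_simps)
      also have "\<dots> \<le> ?q ^ dim_bound (n - e) * ?c1 * (?q ^ dim_bound (n - e') * ?c2)"
        using bound_W' bound_U' by (rule mult_le_mono)
      also have "\<dots> = ?q ^ dim_bound (n - e) * ?q ^ dim_bound (n - e') * (?c1 * ?c2)"
        by (simp only: ac_simps)
      also have "\<dots> \<le> ?q ^ dim_bound (n - e) * ?q ^ dim_bound (n - e') * (?q ^ n * ?c * ?c)"
        using c12 by (rule mult_le_mono2)
      also have "\<dots> = ?q ^ (dim_bound (n - e) + dim_bound (n - e') + n) * (?c * ?c)"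
        by (simp add: power_add ac_simps)
      finally have "?q ^ (2 * a) \<le> ?q ^ (dim_bound (n - e) + dim_bound (n - e') + n)"
        using card_ideal_pos[OF I0] by simp
      then have "2 * a \<le> dim_bound (n - e) + dim_bound (n - e') + n" using q by simp
      then have "a \<le> dim_bound n"
        using dim_bound_double \<open>e > 0\<close> \<open>e' > 0\<close> \<open>f > 0\<close> \<open>f' > 0\<close> f_eq f'_eq by simp
      then show ?thesis using a q by simp
    next
      case False
      \<comment> \<open>\<open>W'/W\<close> and \<open>U'/W\<close> are complementary in
        \<open>U/W\<close>: they meet in zero by minimality of \<open>W'\<close> and span by
        maximality of \<open>U'\<close>. Writing \<open>id w\<close> makes the sum an instance of
        \<open>submodule_image\<close>.\<close>
      have "W' \<inter> U' = W' \<or> W' \<inter> U' = W"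
        using min submodule_Int[OF W' U'(1)] WW' U' unfolding minimal_over_def by blast
      then have int: "W' \<inter> U' = W" using False by blast
      define S where "S = (\<lambda>(w, u). id w + u) ` (W' \<times> U')"
      have S: "submodule S" unfolding S_def using submodule_image[OF W' U'(1) id_A] by simp
      have "u \<in> S" if "u \<in> U'" for u
        unfolding S_def using that submoduleD(2)[OF W'] by (intro image_eqI[of _ _ "(0, u)"]) auto
      moreover have "w \<in> S" if "w \<in> W'" for w
        unfolding S_def using that submoduleD(2)[OF U'(1)] by (intro image_eqI[of _ _ "(w, 0)"]) auto
      moreover have "S \<subseteq> U" unfolding S_def using submoduleD(3)[OF U] W'U U'(3) by (auto dest: subsetD)
      ultimately have SU: "S = U" using max[OF S] False by blast
      obtain w where w: "w \<in> W'" "w \<notin> W" "w \<in> U" using WW' W'U by blast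
      let ?I = "ann U W'"
      have I: "ideal ?I" using ideal_ann W' by blast
      \<comment> \<open>By minimality \<open>W' = A w + W\<close>. An operator in
        \<open>ann U W'\<close> maps \<open>U'\<close> into \<open>W' \<inter> U' = W\<close>, so
        modulo \<open>ann U W\<close> it is determined by its value at \<open>w\<close> in
        \<open>W'/W\<close>, which leaves at most \<open>?q ^ e\<close> classes.\<close>
      define V where "V = (\<lambda>(a, u). a w + u) ` (A \<times> W)"
      have V: "submodule V" unfolding V_def using submodule_orbit ideal_A W by blast
      have "u \<in> V" if "u \<in> W" for u
        unfolding V_def using that zero_A by (intro image_eqI[of _ _ "(0, u)"]) auto
      moreover have "w \<in> V"
        unfolding V_def using id_A submoduleD(2)[OF W] by (intro image_eqI[of _ _ "(id, 0)"]) auto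
      moreover have "V \<subseteq> W'" unfolding V_def using submoduleD[OF W'] w WW' by auto
      ultimately have VW': "V = W'" using min V w unfolding minimal_over_def by blast
      have "{b \<in> ?I. b w \<in> W} = ann U W"
      proof
        show "ann U W \<subseteq> {b \<in> ?I. b w \<in> W}" using w W'U WW' unfolding ann_def by blast
        show "{b \<in> ?I. b w \<in> W} \<subseteq> ann U W"
        proof
          fix b assume "b \<in> {b \<in> ?I. b w \<in> W}"
          then have b: "b \<in> A" "\<And>u. u \<in> U \<Longrightarrow> b u \<in> W'" "b w \<in> W" by (auto simp: ann_def)
          have bV: "b (a w + u) \<in> W" if "a \<in> A" "u \<in> W" for a u
          proof -
            have "b (a w + u) = a (b w) + b u"
              using A_add[OF b(1)] A_commute[OF b(1) that(1)] by simp
            then show ?thesis using b that submoduleD[OF W] by simp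
          qed
          then have "b x \<in> W" if "x \<in> W'" for x using VW' that by (auto simp: V_def)
          moreover have "b x \<in> W" if "x \<in> U'" for x
            using that b submoduleD(4)[OF U'(1)] U' int by blast
          ultimately have "b (x + y) \<in> W" if "x \<in> W'" "y \<in> U'" for x y
            using A_add[OF b(1)] submoduleD(3)[OF W] that by simp
          then show "b \<in> ann U W" using b(1) SU by (auto simp: ann_def S_def)
        qed
      qed
      moreover have "card ?I * card W
          = card {b \<in> ?I. b w \<in> W} * card ((\<lambda>(b, u). b w + u) ` (?I \<times> W))"
        using idealD[OF I] ideal_diff_closed[OF I] submoduleD(1)[OF W] submodule_diff_closed[OF W]
        by (intro card_hom_preimage) auto
      moreover have "(\<lambda>(b, u). b w + u) ` (?I \<times> W) \<subseteq> W'"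
        using submoduleD(3)[OF W'] WW' w by (auto simp: ann_def)
      note mult_le_mono2[OF card_mono[OF submoduleD(1)[OF W'] this]]
      ultimately have "card ?I * card W \<le> card (ann U W) * card W'" by simp
      then have "card ?I * card W \<le> ?q ^ e * card (ann U W) * card W" using e by (simp add: ac_simps)
      then have "card ?I \<le> ?q ^ e * card (ann U W)" using posW by simp
      then have "?q ^ dim_bound (n - e) * card ?I \<le> ?q ^ dim_bound (n - e) * (?q ^ e * card (ann U W))"
        by (rule mult_le_mono2)
      also have "\<dots> = ?q ^ (dim_bound (n - e) + e) * card (ann U W)"
        by (simp add: power_add ac_simps)
      also have "\<dots> \<le> ?q ^ dim_bound n * card (ann U W)"
        using dim_bound_add[OF \<open>e > 0\<close> \<open>e \<le> n\<close>] q by (intro mult_right_mono power_increasing) auto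
      finally show ?thesis using bound_W' by linarith
    qed
  qed
qed

end

section \<open>The action of matrices on functions\<close>

text \<open>\<open>nat \<Rightarrow> 'a\<close> is treated as a direct sum of copies of \<open>'a^n\<close>, with a block-diagonal action, so
  that the identity matrix acts as the identity function.\<close>

definition mat_op :: "nat \<Rightarrow> 'a::field mat \<Rightarrow> (nat \<Rightarrow> 'a) \<Rightarrow> nat \<Rightarrow> 'a" where
  "mat_op n M v i = (\<Sum>k<n. M $$ (i mod n, k) * v (n * (i div n) + k))"

lemma mat_op_plus:
  assumes "n > 0" "M \<in> carrier_mat n n" "N \<in> carrier_mat n n"
  shows "mat_op n (M + N) v = (\<lambda>i. mat_op n M v i + mat_op n N v i)"
  using assms by (simp add: mat_op_def fun_eq_iff algebra_simps sum.distrib)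

lemma mat_op_mult:
  assumes "n > 0" "M \<in> carrier_mat n n" "N \<in> carrier_mat n n"
  shows "mat_op n (M * N) v = mat_op n M (mat_op n N v)"
proof
  fix i
  have "mat_op n (M * N) v i
      = (\<Sum>k<n. (\<Sum>j<n. M $$ (i mod n, j) * N $$ (j, k)) * v (n * (i div n) + k))"
    using assms by (simp add: mat_op_def scalar_prod_def lessThan_atLeast0)
  also have "\<dots> = (\<Sum>j<n. \<Sum>k<n. M $$ (i mod n, j) * N $$ (j, k) * v (n * (i div n) + k))"
    unfolding sum_distrib_right by (rule sum.swap)
  \<comment> \<open>For \<open>j < n\<close> the index \<open>n * (i div n) + j\<close> has quotient
    \<open>i div n\<close> and remainder \<open>j\<close>.\<close>
  also have "\<dots> = mat_op n M (mat_op n N v) i"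
    by (simp add: mat_op_def sum_distrib_left mult.assoc)
  finally show "mat_op n (M * N) v i = mat_op n M (mat_op n N v) i" .
qed

lemma mat_op_scalar:
  assumes "n > 0"
  shows "mat_op n (c \<cdot>\<^sub>m 1\<^sub>m n) v = (\<lambda>i. c * v i)"
proof
  fix i
  have "mat_op n (c \<cdot>\<^sub>m 1\<^sub>m n) v i = (\<Sum>k<n. if i mod n = k then c * v (n * (i div n) + k) else 0)"
    unfolding mat_op_def using assms by (intro sum.cong) auto
  also have "\<dots> = c * v i" using assms by (simp add: sum.delta)
  finally show "mat_op n (c \<cdot>\<^sub>m 1\<^sub>m n) v i = c * v i" .
qed

text \<open>Recovers a matrix from its action on the first block, which makes the action
  faithful.\<close>

lemma mat_op_unit:
  assumes "i < n" "j < n"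
  shows "mat_op n M (\<lambda>k. if k = j then 1 else 0) i = M $$ (i, j)"
  using assms by (simp add: mat_op_def if_distrib cong: if_cong)

lemma card_finitely_supported:
  "card {v :: nat \<Rightarrow> 'a::{finite,zero}. \<forall>i\<ge>n. v i = 0} = CARD('a) ^ n"
proof -
  have "bij_betw (\<lambda>v. restrict v {..<n}) {v :: nat \<Rightarrow> 'a. \<forall>i\<ge>n. v i = 0} ({..<n} \<rightarrow>\<^sub>E UNIV)"
    by (rule bij_betwI[where g = "\<lambda>f i. if i < n then f i else 0"])
       (auto simp: fun_eq_iff restrict_def PiE_def extensional_def)
  then show ?thesis by (simp add: bij_betw_same_card card_PiE)
qed

text \<open>Schur's bound for commutative matrix algebras, due to Jacobson over arbitrary fields.\<close>

theorem card_commutative_matrix_algebra: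
  fixes B :: "'a::{field,finite} mat set"
  assumes n: "n > 0" and B: "B \<subseteq> carrier_mat n n"
    and plus: "\<And>M N. M \<in> B \<Longrightarrow> N \<in> B \<Longrightarrow> M + N \<in> B"
    and times: "\<And>M N. M \<in> B \<Longrightarrow> N \<in> B \<Longrightarrow> M * N \<in> B"
    and scalar: "\<And>c. c \<cdot>\<^sub>m 1\<^sub>m n \<in> B"
    and commute: "\<And>M N. M \<in> B \<Longrightarrow> N \<in> B \<Longrightarrow> M * N = N * M"
  shows "card B \<le> CARD('a) ^ m_exp n"
proof -
  let ?scale = "\<lambda>(c :: 'a) (v :: nat \<Rightarrow> 'a) i. c * v i"
  let ?A = "mat_op n ` B"
  have Bc: "M \<in> carrier_mat n n" if "M \<in> B" for M using B that by blast
  interpret commutative_operators ?scale ?A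
  proof unfold_locales
    show "finite ?A" using finite_subset[OF B finite_carrier_mat] by simp
    show "a (x + y) = a x + a y" if "a \<in> ?A" for a x y
      using that by (auto simp: mat_op_def fun_eq_iff algebra_simps sum.distrib)
    show "(\<lambda>x. a x + b x) \<in> ?A" if ab: "a \<in> ?A" "b \<in> ?A" for a b
    proof -
      obtain M N where "M \<in> B" "N \<in> B" "a = mat_op n M" "b = mat_op n N" using ab by blast
      then show ?thesis using plus mat_op_plus[OF n Bc Bc]
        by (intro image_eqI[of _ _ "M + N"]) (auto simp: fun_eq_iff)
    qed
    show "(\<lambda>x. a (b x)) \<in> ?A" if ab: "a \<in> ?A" "b \<in> ?A" for a b
    proof -
      obtain M N where "M \<in> B" "N \<in> B" "a = mat_op n M" "b = mat_op n N" using ab by blast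
      then show ?thesis using times mat_op_mult[OF n Bc Bc]
        by (intro image_eqI[of _ _ "M * N"]) auto
    qed
    show "?scale c \<in> ?A" for c
      using scalar by (intro image_eqI[of _ _ "c \<cdot>\<^sub>m 1\<^sub>m n"] ext) (auto simp: mat_op_scalar[OF n])
    show "a (b x) = b (a x)" if ab: "a \<in> ?A" "b \<in> ?A" for a b x
    proof -
      obtain M N where "M \<in> B" "N \<in> B" "a = mat_op n M" "b = mat_op n N" using ab by blast
      then show ?thesis using commute mat_op_mult[OF n Bc Bc] by metis
    qed
  qed (auto simp: fun_eq_iff algebra_simps)
  \<comment> \<open>The first block, a copy of the \<open>n\<close>-dimensional column space; it is
    stable because the action does not mix blocks.\<close>
  let ?V = "{v :: nat \<Rightarrow> 'a. \<forall>i\<ge>n. v i = 0}"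
  have cardV: "card ?V = CARD('a) ^ n" by (rule card_finitely_supported)
  then have "finite ?V" by (intro card_ge_0_finite) simp
  moreover have "mat_op n M v i = 0" if "v \<in> ?V" "n \<le> i" for M v i
  proof -
    have "1 \<le> i div n" using that n by (simp add: div_greater_zero_iff Suc_le_eq)
    then have "n * 1 \<le> n * (i div n)" by (rule mult_le_mono2)
    then have "n \<le> n * (i div n) + k" for k by linarith
    then have "v (n * (i div n) + k) = 0" for k using that(1) by blast
    then show ?thesis by (simp add: mat_op_def)
  qed
  ultimately have V: "submodule ?V" by (auto simp: submodule_def)
  have zero: "submodule {0}" using A_0 by (auto simp: submodule_def)
  \<comment> \<open>By faithfulness on the first block the annihilator vanishes, so the bound on its
    index is a bound on \<open>card ?A\<close>.\<close>
  have "ann ?V {0} \<subseteq> {0}"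
  proof
    fix a assume "a \<in> ann ?V {0}"
    then obtain M where M: "M \<in> B" "a = mat_op n M" "\<And>v. v \<in> ?V \<Longrightarrow> mat_op n M v = 0"
      by (auto simp: ann_def)
    have "M $$ (i, j) = 0" if "i < n" "j < n" for i j
      using mat_op_unit[OF that, of M] M(3)[of "\<lambda>k. if k = j then 1 else 0"] that by simp
    then have "a = 0" using M(2) n by (simp add: mat_op_def fun_eq_iff)
    then show "a \<in> {0}" by simp
  qed
  from card_mono[OF _ this] have ann: "card (ann ?V {0}) \<le> 1" by simp
  have "inj_on (mat_op n) B"
  proof (rule inj_onI)
    fix M N assume MN: "M \<in> B" "N \<in> B" "mat_op n M = mat_op n N"
    then have "M $$ (i, j) = N $$ (i, j)" if "i < n" "j < n" for i j
      using mat_op_unit[OF that] by metis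
    then show "M = N" using Bc[OF MN(1)] Bc[OF MN(2)] by (intro eq_matI) auto
  qed
  then have "card B = card ?A" by (simp add: card_image)
  also have "\<dots> \<le> CARD('a) ^ dim_bound n * card (ann ?V {0})"
    using card_le_ann[OF V zero] cardV by auto
  also have "\<dots> \<le> CARD('a) ^ dim_bound n * 1" using ann by (rule mult_le_mono2)
  finally show ?thesis using n by (simp add: dim_bound_def m_exp_def)
qed

section \<open>Centralizers and the upper bound\<close>

definition centralizer :: "nat \<Rightarrow> 'a::field mat set \<Rightarrow> 'a mat set" where
  "centralizer n S = {X \<in> carrier_mat n n. \<forall>s\<in>S. X * s = s * X}"

lemma centralizer_closed:
  assumes S: "S \<subseteq> carrier_mat n n"
  shows "M \<in> centralizer n S \<Longrightarrow> N \<in> centralizer n S \<Longrightarrow> M + N \<in> centralizer n S"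
    and "M \<in> centralizer n S \<Longrightarrow> N \<in> centralizer n S \<Longrightarrow> M * N \<in> centralizer n S"
    and "c \<cdot>\<^sub>m 1\<^sub>m n \<in> centralizer n S"
proof -
  have c: "s \<in> carrier_mat n n" if "s \<in> S" for s using S that by blast
  show "M + N \<in> centralizer n S" if "M \<in> centralizer n S" "N \<in> centralizer n S"
    using that by (auto simp: centralizer_def add_mult_distrib_mat[OF _ _ c] mult_add_distrib_mat[OF c])
  show "c \<cdot>\<^sub>m 1\<^sub>m n \<in> centralizer n S"
    using c by (auto simp: centralizer_def mult_smult_assoc_mat[OF one_carrier_mat c]
        mult_smult_distrib[OF c one_carrier_mat] left_mult_one_mat[OF c] right_mult_one_mat[OF c])
  show "M * N \<in> centralizer n S" if MN: "M \<in> centralizer n S" "N \<in> centralizer n S"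
  proof -
    have M: "M \<in> carrier_mat n n" and N: "N \<in> carrier_mat n n"
      using MN by (auto simp: centralizer_def)
    have "M * N * s = s * (M * N)" if "s \<in> S" for s
    proof -
      have "M * N * s = M * (s * N)"
        using assoc_mult_mat[OF M N c[OF that]] MN that by (auto simp: centralizer_def)
      also have "\<dots> = s * M * N"
        using assoc_mult_mat[OF M c[OF that] N] MN that by (auto simp: centralizer_def)
      also have "\<dots> = s * (M * N)" using assoc_mult_mat[OF c[OF that] M N] .
      finally show ?thesis .
    qed
    then show ?thesis using M N by (auto simp: centralizer_def)
  qed
qed

text \<open>A commuting set lies in its centralizer, so its bicommutant does too; the bicommutant
  commutes with that centralizer and hence with itself. Being a centralizer, it is an
  algebra.\<close>

lemma card_bicommutant:
  fixes S :: "'a::{field,finite} mat set"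
  assumes "n > 0" and S: "S \<subseteq> carrier_mat n n"
    and commute: "\<And>M N. M \<in> S \<Longrightarrow> N \<in> S \<Longrightarrow> M * N = N * M"
  shows "card (centralizer n (centralizer n S)) \<le> CARD('a) ^ m_exp n"
proof -
  have c: "centralizer n T \<subseteq> carrier_mat n n" for T :: "'a mat set"
    by (auto simp: centralizer_def)
  have sub: "S \<subseteq> centralizer n S" using S commute by (auto simp: centralizer_def)
  show ?thesis
  proof (rule card_commutative_matrix_algebra[OF \<open>n > 0\<close> c])
    show "M * N = N * M"
      if "M \<in> centralizer n (centralizer n S)" "N \<in> centralizer n (centralizer n S)" for M N
    proof -
      have "N \<in> centralizer n S" using that(2) sub by (auto simp: centralizer_def)
      then show ?thesis using that(1) by (simp add: centralizer_def)
    qed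
  qed (use centralizer_closed[OF c] in auto)
qed

lemma num_commuting_tuples_upper:
  assumes "n > 0"
  shows "num_commuting_tuples TYPE('a::{field,finite}) n k
    \<le> card (Pow (carrier_mat n n :: 'a mat set)) * CARD('a) ^ (m_exp n * k)"
proof -
  let ?q = "CARD('a)"
  define \<B> where "\<B> = {B \<in> Pow (carrier_mat n n :: 'a mat set). card B \<le> ?q ^ m_exp n}"
  let ?L = "\<lambda>B :: 'a mat set. {xs. set xs \<subseteq> B \<and> length xs = k}"
  have fin: "finite (Pow (carrier_mat n n :: 'a mat set))" using finite_carrier_mat by simp
  have finB: "finite B" if "B \<in> \<B>" for B
    using that finite_carrier_mat finite_subset by (auto simp: \<B>_def)
  have sub: "(commuting_tuples n k :: 'a mat list set) \<subseteq> (\<Union>B\<in>\<B>. ?L B)"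
  proof
    fix As :: "'a mat list" assume As: "As \<in> commuting_tuples n k"
    let ?B = "centralizer n (centralizer n (set As))"
    have comm: "M * N = N * M" if "M \<in> set As" "N \<in> set As" for M N
      using As that by (auto simp: commuting_tuples_def in_set_conv_nth)
    have c: "set As \<subseteq> carrier_mat n n" using As by (simp add: commuting_tuples_def)
    have "?B \<in> \<B>"
      unfolding \<B>_def using card_bicommutant[OF assms c comm] by (auto simp: centralizer_def)
    moreover have "set As \<subseteq> ?B" using c by (auto simp: centralizer_def)
    ultimately show "As \<in> (\<Union>B\<in>\<B>. ?L B)" using As by (auto simp: commuting_tuples_def)
  qed
  have fB: "finite \<B>" using fin by (simp add: \<B>_def)
  have "num_commuting_tuples TYPE('a) n k \<le> card (\<Union>B\<in>\<B>. ?L B)"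
    unfolding num_commuting_tuples_def using sub fB finB
    by (intro card_mono finite_UN_I) (auto intro: finite_lists_length_eq)
  also have "\<dots> \<le> (\<Sum>B\<in>\<B>. card (?L B))" using fB by (rule card_UN_le)
  also have "\<dots> = (\<Sum>B\<in>\<B>. card B ^ k)" using finB by (simp add: card_lists_length_eq)
  also have "\<dots> \<le> (\<Sum>B\<in>\<B>. (?q ^ m_exp n) ^ k)"
    by (intro sum_mono power_mono) (auto simp: \<B>_def)
  also have "\<dots> = card \<B> * ?q ^ (m_exp n * k)" by (simp add: power_mult)
  also have "\<dots> \<le> card (Pow (carrier_mat n n :: 'a mat set)) * ?q ^ (m_exp n * k)"
    using fin by (intro mult_right_mono card_mono) (auto simp: \<B>_def)
  finally show ?thesis .
qed

section \<open>Scalars plus a block and the lower bound\<close>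

text \<open>The block lies strictly above the diagonal and is as near to square as possible. Its row
  indices and column indices are disjoint, so products of two blocks vanish.\<close>

definition scalar_plus_block :: "nat \<Rightarrow> 'a::field \<times> (nat \<times> nat \<Rightarrow> 'a) \<Rightarrow> 'a mat" where
  "scalar_plus_block n = (\<lambda>(c, g). mat n n (\<lambda>(i, j).
     (if i = j then c else 0) + (if i < n div 2 \<and> n div 2 \<le> j then g (i, j) else 0)))"

lemma scalar_plus_block_mult:
  "scalar_plus_block n (c, g) * scalar_plus_block n (d, h)
    = scalar_plus_block n (c * d, \<lambda>p. c * h p + d * g p)"
proof (rule eq_matI)
  fix i j
  assume "i < dim_row (scalar_plus_block n (c * d, \<lambda>p. c * h p + d * g p))"
    and "j < dim_col (scalar_plus_block n (c * d, \<lambda>p. c * h p + d * g p))"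
  then have ij: "i < n" "j < n" by (auto simp: scalar_plus_block_def)
  let ?r = "n div 2"
  let ?G = "\<lambda>i j. if i < ?r \<and> ?r \<le> j then g (i, j) else 0"
  let ?H = "\<lambda>i j. if i < ?r \<and> ?r \<le> j then h (i, j) else 0"
  have "(scalar_plus_block n (c, g) * scalar_plus_block n (d, h)) $$ (i, j)
      = (\<Sum>k<n. ((if i = k then c else 0) + ?G i k) * ((if k = j then d else 0) + ?H k j))"
    using ij by (simp add: scalar_plus_block_def scalar_prod_def lessThan_atLeast0)
  \<comment> \<open>The term \<open>?G i k * ?H k j\<close> drops out: it would require both
    \<open>n div 2 \<le> k\<close> and \<open>k < n div 2\<close>.\<close>
  also have "\<dots> = (\<Sum>k<n. (if i = k then c * ((if k = j then d else 0) + ?H k j) else 0)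
      + (if k = j then ?G i k * d else 0))"
    by (intro sum.cong) (auto simp: algebra_simps)
  also have "\<dots> = c * ((if i = j then d else 0) + ?H i j) + ?G i j * d"
    using ij by (simp only: sum.distrib sum.delta sum.delta' finite_lessThan lessThan_iff if_True)
  also have "\<dots> = scalar_plus_block n (c * d, \<lambda>p. c * h p + d * g p) $$ (i, j)"
    using ij by (auto simp: scalar_plus_block_def algebra_simps)
  finally show "(scalar_plus_block n (c, g) * scalar_plus_block n (d, h)) $$ (i, j)
      = scalar_plus_block n (c * d, \<lambda>p. c * h p + d * g p) $$ (i, j)" .
qed (simp_all add: scalar_plus_block_def)

lemma half_times_half: "(n div 2) * (n - n div 2) = n\<^sup>2 div 4" for n :: nat
proof (cases "even n")
  case True
  then obtain k where "n = 2 * k" by blast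
  then show ?thesis by (simp add: power2_eq_square)
next
  case False
  then obtain k where k: "n = 2 * k + 1" by (elim oddE)
  have "n\<^sup>2 = 1 + 4 * (k * (k + 1))" by (simp add: k power2_eq_square algebra_simps)
  then have "n\<^sup>2 div 4 = k * (k + 1)" by simp
  then show ?thesis by (simp add: k)
qed

lemma num_commuting_tuples_lower:
  assumes "n > 0"
  shows "CARD('a) ^ (m_exp n * k) \<le> num_commuting_tuples TYPE('a::{field,finite}) n k"
proof -
  let ?r = "n div 2"
  \<comment> \<open>Extensional functions on the block positions, so that distinct parameters give
    distinct matrices.\<close>
  define P :: "('a \<times> (nat \<times> nat \<Rightarrow> 'a)) set"
    where "P = UNIV \<times> ({..<?r} \<times> {?r..<n} \<rightarrow>\<^sub>E UNIV)"
  let ?f = "scalar_plus_block n :: _ \<Rightarrow> 'a mat"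
  have cardP: "card P = CARD('a) ^ m_exp n"
    by (simp add: P_def card_cartesian_product card_PiE half_times_half m_exp_def)
  have inj: "inj_on ?f P"
  proof (rule inj_onI)
    fix x y assume xy: "x \<in> P" "y \<in> P" "?f x = ?f y"
    obtain c g d h where x: "x = (c, g)" and y: "y = (d, h)" by (cases x, cases y)
    have entry: "?f (c, g) $$ (i, j) = ?f (d, h) $$ (i, j)" for i j using xy x y by simp
    \<comment> \<open>The position \<open>(0, 0)\<close> exists as \<open>n > 0\<close> and is never
      in the block.\<close>
    have c: "c = d" using entry[of 0 0] assms by (simp add: scalar_plus_block_def split: if_splits)
    have "g p = h p" if "p \<in> {..<?r} \<times> {?r..<n}" for p
      using that entry[of "fst p" "snd p"] by (cases p) (auto simp: scalar_plus_block_def)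
    then have "g = h" using xy x y by (intro PiE_ext[of g _ _ h]) (auto simp: P_def)
    then show "x = y" using c x y by simp
  qed
  have comm: "M * N = N * M" if MN: "M \<in> ?f ` P" "N \<in> ?f ` P" for M N
  proof -
    obtain c g d h where "M = ?f (c, g)" "N = ?f (d, h)" using MN by auto
    then show ?thesis by (simp add: scalar_plus_block_mult mult.commute add.commute)
  qed
  have "{xs. set xs \<subseteq> ?f ` P \<and> length xs = k} \<subseteq> commuting_tuples n k"
  proof clarify
    fix xs :: "'a mat list" assume xs: "set xs \<subseteq> ?f ` P" "k = length xs"
    have "xs ! i \<in> ?f ` P" if "i < length xs" for i using xs that nth_mem by blast
    moreover have "?f ` P \<subseteq> carrier_mat n n" by (auto simp: scalar_plus_block_def)
    ultimately show "xs \<in> commuting_tuples n (length xs)" using comm xs by (auto simp: commuting_tuples_def)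
  qed
  then have "card {xs. set xs \<subseteq> ?f ` P \<and> length xs = k} \<le> num_commuting_tuples TYPE('a) n k"
    unfolding num_commuting_tuples_def using finite_commuting_tuples by (intro card_mono)
  moreover have "finite P" by (simp add: P_def finite_PiE)
  then have "card {xs. set xs \<subseteq> ?f ` P \<and> length xs = k} = CARD('a) ^ (m_exp n * k)"
    by (simp add: card_lists_length_eq card_image[OF inj] cardP power_mult)
  ultimately show ?thesis by simp
qed

theorem theorem2:
  fixes n q :: nat
  assumes "n > 0" and "CARD('a :: {field, finite}) = q"
  shows "\<exists>D\<^sub>1 D\<^sub>2 :: real. D\<^sub>1 > 0 \<and> D\<^sub>2 > 0 \<and>
    (\<forall>\<^sub>F k in sequentially.
       D\<^sub>1 * real q ^ (m_exp n * k) \<le> real (num_commuting_tuples TYPE('a) n k) \<and>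
       real (num_commuting_tuples TYPE('a) n k) \<le> D\<^sub>2 * real q ^ (m_exp n * k))"
proof (intro exI conjI always_eventually allI)
  \<comment> \<open>The constants are 1 and the number of subsets of the matrix algebra; with them
    both bounds hold for every \<open>k\<close>.\<close>
  let ?D = "real (card (Pow (carrier_mat n n :: 'a mat set)))"
  show "(1 :: real) > 0" by simp
  show "?D > 0" by (simp add: card_Pow finite_carrier_mat)
  fix k
  show "1 * real q ^ (m_exp n * k) \<le> real (num_commuting_tuples TYPE('a) n k)"
    using num_commuting_tuples_lower[OF assms(1), where 'a = 'a, of k] assms(2)
    by (metis mult_1 of_nat_le_iff of_nat_power)
  show "real (num_commuting_tuples TYPE('a) n k) \<le> ?D * real q ^ (m_exp n * k)"
    using num_commuting_tuples_upper[OF assms(1), where 'a = 'a, of k] assms(2)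
    by (metis of_nat_le_iff of_nat_mult of_nat_power)
qed

end
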